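(* Let $(H;\langle\cdot,\cdot\rangle)$ be an inner product space over $\mathbb{K}$ and $x,y,e\in H$ with $\|e\|=1$. Suppose also that $a,A,b,B\in\mathbb{K}$ are such that $A\ne\pm a$ and $B\neq\pm b$. If either $$\operatorname{Re}\langle Ae-x,\,x-ae\rangle\ge0,\qquad \operatorname{Re}\langle Be-y,\,y-be\rangle\ge0,$$ or, equivalently, $$\left\|x-\frac{a+A}{2}e\right\|\le\frac12|A-a|,\qquad \left\|y-\frac{b+B}{2}e\right\|\le\frac12|B-b|$$ holds, then $$|\langle x,y\rangle-\langle x,e\rangle\langle e,y\rangle| \le \frac14\cdot\frac{|A-a||B-b|}{\sqrt{|A+a||B+b|}}\sqrt{\|x\|+|\langle x,e\rangle|}\cdot\sqrt{\|y\|+|\langle y,e\rangle|} \le \frac12\cdot\frac{|A-a||B-b|}{\sqrt{|A+a||B+b|}}\sqrt{\|x\|\|y\|} .$$ The constant $\frac14$ is best possible: there is no $c<\frac14$ such that the first inequality holds with $c$ in place of $\frac14$ for all inner product spaces $H$ over $\mathbb{K}$ and all $x,y,e\in H$, $a,A,b,B\in\mathbb{K}$ with $\|e\|=1$, $A\ne\pm a$, $B\ne\pm b$, $\operatorname{Re}\langle Ae-x,\,x-ae\rangle\ge0$ and $\operatorname{Re}\langle Be-y,\,y-be\rangle\ge0$.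
   Context: $\mathbb{K}$ denotes $\mathbb{R}$ or $\mathbb{C}$. Inner products are linear in the first argument and conjugate-linear in the second, and $\|x\|=\langle x,x\rangle^{1/2}$. *)

theory Defs
  imports Complex_Main "HOL-Algebra.Module"
begin

(* A set K of complex numbers as a HOL-Algebra ring with the usual operations; it is used with
   K = \<real> and K = UNIV, so that real and complex spaces are treated together. *)
definition scalar_ring :: "complex set \<Rightarrow> complex ring" where
  "scalar_ring K = \<lparr>carrier = K, monoid.mult = (*), one = 1, ring.zero = 0, add = (+)\<rparr>"

(* The fields mult and one of the HOL-Algebra record H play no role in a module. *)
locale inner_product_space = module "scalar_ring K" H
  for K :: "complex set" and H :: "(complex, 'v) module" (structure) +
  fixes ip :: "'v \<Rightarrow> 'v \<Rightarrow> complex"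
  assumes scalars: "K = \<real> \<or> K = UNIV"
    and ip_closed: "\<lbrakk>x \<in> carrier H; y \<in> carrier H\<rbrakk> \<Longrightarrow> ip x y \<in> K"
    and ip_add_left:
      "\<lbrakk>x \<in> carrier H; y \<in> carrier H; z \<in> carrier H\<rbrakk> \<Longrightarrow> ip (x \<oplus> y) z = ip x z + ip y z"
    and ip_smult_left:
      "\<lbrakk>c \<in> K; x \<in> carrier H; y \<in> carrier H\<rbrakk> \<Longrightarrow> ip (c \<odot> x) y = c * ip x y"
    and ip_commute: "\<lbrakk>x \<in> carrier H; y \<in> carrier H\<rbrakk> \<Longrightarrow> ip y x = cnj (ip x y)"
    and ip_nonneg: "x \<in> carrier H \<Longrightarrow> 0 \<le> Re (ip x x)"
    and ip_definite: "\<lbrakk>x \<in> carrier H; ip x x = 0\<rbrakk> \<Longrightarrow> x = \<zero>"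

(* ip x x is real by conjugate symmetry, so taking the real part loses nothing. *)
definition ip_norm :: "('v \<Rightarrow> 'v \<Rightarrow> complex) \<Rightarrow> 'v \<Rightarrow> real" where
  "ip_norm ip x = sqrt (Re (ip x x))"

end

(* The polarisation identity
     Re <Ae - x, x - ae> = |A - a|^2 / 4 - ||x - (a+A)/2 e||^2
   gives the equivalence. Expanding the ball condition and using AM-GM in the form
   |A+a| ||x|| <= ||x||^2 + |A+a|^2 / 4 yields |A+a| (||x|| - |<x,e>|) <= |A-a|^2 / 4; multiplied by
   ||x|| + |<x,e>| this bounds ||x - <x,e>e||^2. The left-hand side of the claim is the inner
   product of x - <x,e>e and y - <y,e>e, so Cauchy-Schwarz finishes the proof.
   Both steps are equalities in the plane for e = (1,0), x = y = (7,24), a = b = -5, A = B = 55. *)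
theory Submission
  imports Defs
begin

section \<open>The scalar field as a ring\<close>

lemma scalar_ring_simps [simp]:
  "carrier (scalar_ring K) = K" "x \<otimes>\<^bsub>scalar_ring K\<^esub> y = x * y" "\<one>\<^bsub>scalar_ring K\<^esub> = 1"
  "\<zero>\<^bsub>scalar_ring K\<^esub> = 0" "x \<oplus>\<^bsub>scalar_ring K\<^esub> y = x + y"
  by (simp_all add: scalar_ring_def)

text \<open>Inside the locale this comes with \<open>module\<close>; it is proved separately to
  construct the concrete space \<open>plane K\<close>.\<close>

lemma cring_scalar_ring:
  assumes "K = \<real> \<or> K = UNIV"
  shows "cring (scalar_ring K)"
proof -
  have closed: "0 \<in> K" "1 \<in> K" "\<And>x y. x \<in> K \<Longrightarrow> y \<in> K \<Longrightarrow> x + y \<in> K"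
      "\<And>x y. x \<in> K \<Longrightarrow> y \<in> K \<Longrightarrow> x * y \<in> K" "\<And>x. x \<in> K \<Longrightarrow> - x \<in> K"
    using assms by auto
  have "\<exists>y\<in>K. y + x = 0" if "x \<in> K" for x
    using closed(5)[OF that] by (intro bexI[of _ "- x"]) auto
  then show ?thesis
    by (intro cringI abelian_groupI comm_monoidI) (auto simp: closed algebra_simps)
qed

section \<open>Calculus of the inner product\<close>

context inner_product_space
begin

lemma scalar_closed:
  "c \<in> K \<Longrightarrow> d \<in> K \<Longrightarrow> c + d \<in> K" "c \<in> K \<Longrightarrow> c / 2 \<in> K"
  using scalars by auto

lemma smult_in_carrier: "c \<in> K \<Longrightarrow> x \<in> carrier H \<Longrightarrow> c \<odot> x \<in> carrier H"
  using smult_closed by simp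

lemma ip_diff_left:
  assumes "x \<in> carrier H" "y \<in> carrier H" "z \<in> carrier H"
  shows "ip (x \<ominus> y) z = ip x z - ip y z"
proof -
  \<comment> \<open>Adding \<open>y\<close> back reduces subtraction to
    \<open>ip_add_left\<close>.\<close>
  have "(x \<ominus> y) \<oplus> y = x"
    using assms by (simp add: a_minus_def M.a_assoc M.l_neg)
  then show ?thesis
    using ip_add_left[of "x \<ominus> y" y z] assms by simp
qed

lemma ip_diff_right:
  assumes "x \<in> carrier H" "y \<in> carrier H" "z \<in> carrier H"
  shows "ip z (x \<ominus> y) = ip z x - ip z y"
  using assms ip_diff_left[of x y z]
  by (simp add: ip_commute[of "x \<ominus> y" z] ip_commute[of x z] ip_commute[of y z])

lemma ip_smult_right:
  assumes "c \<in> K" "x \<in> carrier H" "y \<in> carrier H"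
  shows "ip x (c \<odot> y) = cnj c * ip x y"
  using assms ip_smult_left[of c y x]
  by (simp add: ip_commute[of "c \<odot> y" x] ip_commute[of y x] smult_in_carrier)

lemmas ip_simps = ip_diff_left ip_diff_right ip_smult_left ip_smult_right
  smult_in_carrier ip_closed

lemma ip_norm_nonneg: "0 \<le> ip_norm ip x" if "x \<in> carrier H"
  using ip_nonneg[OF that] by (simp add: ip_norm_def)

lemma ip_self: "ip x x = of_real ((ip_norm ip x)\<^sup>2)" if "x \<in> carrier H"
proof -
  have "Im (ip x x) = 0"
    using arg_cong[OF ip_commute[OF that that], of Im] by simp
  then show ?thesis
    using ip_nonneg[OF that] by (simp add: ip_norm_def complex_eq_iff)
qed

lemma ip_norm_power2: "(ip_norm ip x)\<^sup>2 = Re (ip x x)" if "x \<in> carrier H"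
  using ip_nonneg[OF that] by (simp add: ip_norm_def)

section \<open>Projection onto a unit vector and Cauchy-Schwarz\<close>

text \<open>Pythagoras: the projection \<open>ip x e \<odot> e\<close> has norm
  \<open>cmod (ip x e)\<close> and is orthogonal to the residual.\<close>

lemma norm_residual:
  assumes "x \<in> carrier H" "e \<in> carrier H" "ip_norm ip e = 1"
  shows "(ip_norm ip (x \<ominus> ip x e \<odot> e))\<^sup>2 = (ip_norm ip x)\<^sup>2 - (cmod (ip x e))\<^sup>2"
proof -
  have "(ip_norm ip (x \<ominus> ip x e \<odot> e))\<^sup>2 = Re (ip (x \<ominus> ip x e \<odot> e) (x \<ominus> ip x e \<odot> e))"
    using assms by (intro ip_norm_power2) (simp add: ip_simps)
  also have "\<dots> = Re (ip x x) - (cmod (ip x e))\<^sup>2"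
    using assms ip_commute[of x e] ip_self[of e]
    by (simp add: ip_simps cmod_power2 flip: power2_eq_square)
  finally show ?thesis
    using assms by (simp add: ip_norm_power2)
qed

text \<open>Bessel's inequality for one unit vector: the squared norm of the residual cannot be
  negative.\<close>

lemma cmod_ip_le_of_unit:
  assumes "x \<in> carrier H" "e \<in> carrier H" "ip_norm ip e = 1"
  shows "cmod (ip x e) \<le> ip_norm ip x"
proof (rule power2_le_imp_le[OF _ ip_norm_nonneg[OF assms(1)]])
  show "(cmod (ip x e))\<^sup>2 \<le> (ip_norm ip x)\<^sup>2"
    using norm_residual[OF assms] zero_le_power2[of "ip_norm ip (x \<ominus> ip x e \<odot> e)"] by linarith
qed

text \<open>Normalising \<open>y\<close> reduces the claim to \<open>cmod_ip_le_of_unit\<close>;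
  only \<open>y\<close> of norm zero has to be treated apart.\<close>

lemma Cauchy_Schwarz:
  assumes x: "x \<in> carrier H" and y: "y \<in> carrier H"
  shows "cmod (ip x y) \<le> ip_norm ip x * ip_norm ip y"
proof (cases "ip_norm ip y = 0")
  case True
  then have "y = \<zero>"
    using ip_definite[OF y] ip_self[OF y] by simp
  \<comment> \<open>Writing the zero vector as a difference lets \<open>ip_diff_right\<close> show
    that its inner product with \<open>x\<close> vanishes.\<close>
  moreover have "y \<ominus> y = \<zero>"
    using y by (simp add: a_minus_def M.r_neg)
  ultimately have "ip x y = 0"
    using ip_diff_right[OF y y x] by simp
  then show ?thesis
    using True by simp
next
  case False
  define r where "r = ip_norm ip y"
  have r: "r > 0"
    using False ip_norm_nonneg[OF y] by (simp add: r_def)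
  define e where "e = of_real (1 / r) \<odot> y"
  have rK: "complex_of_real (1 / r) \<in> K"
    using scalars by auto
  have e: "e \<in> carrier H"
    unfolding e_def using rK y by (rule smult_in_carrier)
  have "ip e e = 1"
    using rK r y ip_self[OF y] by (simp add: e_def ip_simps r_def[symmetric] power2_eq_square)
  then have "ip_norm ip e = 1"
    by (simp add: ip_norm_def)
  then have "cmod (ip x e) \<le> ip_norm ip x"
    by (intro cmod_ip_le_of_unit x e)
  moreover have "cmod (ip x e) = cmod (ip x y) / r"
    using rK r x y by (simp add: e_def ip_simps norm_mult norm_divide)
  ultimately show ?thesis
    using r by (simp add: r_def[symmetric] field_simps)
qed

section \<open>Equivalence of the two hypotheses\<close>

text \<open>The cross terms \<open>A * cnj (ip x e)\<close> and \<open>cnj a * ip x e\<close> merge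
  because conjugate numbers have the same real part. This form serves both the equivalence and the
  estimate of the residual.\<close>

lemma Re_ip_expand:
  assumes "x \<in> carrier H" "e \<in> carrier H" "ip_norm ip e = 1" "a \<in> K" "A \<in> K"
  shows "Re (ip (A \<odot> e \<ominus> x) (x \<ominus> a \<odot> e))
    = Re (cnj (A + a) * ip x e) - (ip_norm ip x)\<^sup>2 - Re (A * cnj a)"
proof -
  have "ip e e = 1"
    using assms by (simp add: ip_self)
  then have "ip (A \<odot> e \<ominus> x) (x \<ominus> a \<odot> e)
      = A * cnj (ip x e) + cnj a * ip x e - ip x x - A * cnj a"
    using assms ip_commute[of x e] by (simp add: ip_simps algebra_simps)
  then show ?thesis
    using assms(1) by (simp only: ip_norm_power2) (simp add: algebra_simps)
qed

text \<open>Polarisation for scalars: it trades the constant term of \<open>Re_ip_expand\<close> for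
  the quantities \<open>A + a\<close> and \<open>A - a\<close>.\<close>

lemma Re_mult_cnj_eq: "Re (A * cnj a) = ((cmod (A + a))\<^sup>2 - (cmod (A - a))\<^sup>2) / 4"
  unfolding cmod_power2 by (simp add: power2_eq_square algebra_simps)

text \<open>Completing the square at the midpoint \<open>s\<close>: the term
  \<open>(cmod s)\<^sup>2\<close> is exactly the \<open>A + a\<close> part of
  \<open>Re_mult_cnj_eq\<close>, so only the \<open>A - a\<close> part survives as the squared
  radius.\<close>

lemma Re_ip_eq:
  assumes "x \<in> carrier H" "e \<in> carrier H" "ip_norm ip e = 1" "a \<in> K" "A \<in> K"
  shows "Re (ip (A \<odot> e \<ominus> x) (x \<ominus> a \<odot> e))
    = (1 / 2 * cmod (A - a))\<^sup>2 - (ip_norm ip (x \<ominus> ((a + A) / 2) \<odot> e))\<^sup>2"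
proof -
  define s where "s = (a + A) / 2"
  have s: "s \<in> K"
    using assms by (simp add: s_def scalar_closed)
  have "ip e e = 1"
    using assms by (simp add: ip_self)
  then have "ip (x \<ominus> s \<odot> e) (x \<ominus> s \<odot> e)
      = ip x x - cnj s * ip x e - s * cnj (ip x e) + s * cnj s"
    using s assms ip_commute[of x e] by (simp add: ip_simps algebra_simps)
  moreover have "(ip_norm ip (x \<ominus> s \<odot> e))\<^sup>2 = Re (ip (x \<ominus> s \<odot> e) (x \<ominus> s \<odot> e))"
    using s assms by (intro ip_norm_power2) (simp add: ip_simps)
  ultimately have "(ip_norm ip (x \<ominus> s \<odot> e))\<^sup>2
      = (ip_norm ip x)\<^sup>2 - 2 * Re (cnj s * ip x e) + (cmod s)\<^sup>2"
    using assms(1) by (simp add: ip_norm_power2 cmod_power2 flip: power2_eq_square)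
  moreover have "2 * Re (cnj s * ip x e) = Re (cnj (A + a) * ip x e)"
    by (simp add: s_def field_simps)
  moreover have "(cmod s)\<^sup>2 = (cmod (A + a))\<^sup>2 / 4"
    by (simp add: s_def norm_divide power_divide add.commute)
  ultimately show ?thesis
    unfolding Re_ip_expand[OF assms] Re_mult_cnj_eq s_def
    by (simp add: power_mult_distrib power_divide diff_divide_distrib)
qed

text \<open>Radius and distance are both nonnegative, so the sign of the difference of their squares
  in \<open>Re_ip_eq\<close> compares them.\<close>

lemma Re_ip_nonneg_iff:
  assumes "x \<in> carrier H" "e \<in> carrier H" "ip_norm ip e = 1" "a \<in> K" "A \<in> K"
  shows "0 \<le> Re (ip (A \<odot> e \<ominus> x) (x \<ominus> a \<odot> e))
    \<longleftrightarrow> ip_norm ip (x \<ominus> ((a + A) / 2) \<odot> e) \<le> 1 / 2 * cmod (A - a)"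
proof -
  have "x \<ominus> ((a + A) / 2) \<odot> e \<in> carrier H"
    using assms by (simp add: smult_in_carrier scalar_closed)
  then show ?thesis
    using abs_le_square_iff[of "ip_norm ip (x \<ominus> ((a + A) / 2) \<odot> e)" "1 / 2 * cmod (A - a)"]
    by (simp add: Re_ip_eq[OF assms] ip_norm_nonneg)
qed

section \<open>The Gruess-type estimate\<close>

text \<open>Controls the smaller factor when the squared norm of the residual is factored as a
  difference of squares.\<close>

lemma norm_diff_le:
  assumes "x \<in> carrier H" "e \<in> carrier H" "ip_norm ip e = 1" "a \<in> K" "A \<in> K"
    and "0 \<le> Re (ip (A \<odot> e \<ominus> x) (x \<ominus> a \<odot> e))"
  shows "cmod (A + a) * (ip_norm ip x - cmod (ip x e)) \<le> (cmod (A - a))\<^sup>2 / 4"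
proof -
  define s where "s = A + a"
  have "Re (cnj s * ip x e) \<le> cmod s * cmod (ip x e)"
    using complex_Re_le_cmod[of "cnj s * ip x e"] by (simp add: norm_mult)
  \<comment> \<open>This is the AM-GM step; equality holds exactly when the norm of \<open>x\<close>
    is half of \<open>cmod s\<close>.\<close>
  moreover have "0 \<le> (ip_norm ip x - cmod s / 2)\<^sup>2"
    by simp
  ultimately show ?thesis
    using assms(6) unfolding Re_ip_expand[OF assms(1-5)] Re_mult_cnj_eq s_def[symmetric]
    by (simp add: power2_diff power_divide field_simps)
qed

lemma norm_residual_le:
  assumes "x \<in> carrier H" "e \<in> carrier H" "ip_norm ip e = 1" "a \<in> K" "A \<in> K" "A \<noteq> - a"
    and "0 \<le> Re (ip (A \<odot> e \<ominus> x) (x \<ominus> a \<odot> e))"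
  shows "ip_norm ip (x \<ominus> ip x e \<odot> e)
    \<le> 1 / 2 * (cmod (A - a) / sqrt (cmod (A + a))) * sqrt (ip_norm ip x + cmod (ip x e))"
proof (rule power2_le_imp_le)
  have pos: "cmod (A + a) > 0"
    using assms(6) by (simp add: eq_neg_iff_add_eq_0)
  have nn: "0 \<le> ip_norm ip x + cmod (ip x e)"
    using assms(1) by (simp add: ip_norm_nonneg)
  have "(ip_norm ip (x \<ominus> ip x e \<odot> e))\<^sup>2
      = (ip_norm ip x - cmod (ip x e)) * (ip_norm ip x + cmod (ip x e))"
    unfolding norm_residual[OF assms(1-3)] by (simp add: power2_eq_square algebra_simps)
  also have "\<dots> \<le> ((cmod (A - a))\<^sup>2 / 4 / cmod (A + a)) * (ip_norm ip x + cmod (ip x e))"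
  proof (rule mult_right_mono[OF _ nn])
    show "ip_norm ip x - cmod (ip x e) \<le> (cmod (A - a))\<^sup>2 / 4 / cmod (A + a)"
      using norm_diff_le[OF assms(1-5,7)] unfolding pos_le_divide_eq[OF pos] by (simp only: mult.commute)
  qed
  \<comment> \<open>The root of the factor 1/4 is the 1/2 in the claim; one such factor from each of
    \<open>x\<close> and \<open>y\<close> gives the final 1/4.\<close>
  also have "\<dots> = (1 / 2 * (cmod (A - a) / sqrt (cmod (A + a)))
      * sqrt (ip_norm ip x + cmod (ip x e)))\<^sup>2"
    using nn by (simp add: power_mult_distrib power_divide)
  finally show "(ip_norm ip (x \<ominus> ip x e \<odot> e))\<^sup>2 \<le> \<dots>" .
  show "0 \<le> 1 / 2 * (cmod (A - a) / sqrt (cmod (A + a))) * sqrt (ip_norm ip x + cmod (ip x e))"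
    using nn by simp
qed

lemma Gruess_inequality:
  assumes x: "x \<in> carrier H" and y: "y \<in> carrier H" and e: "e \<in> carrier H" "ip_norm ip e = 1"
    and a: "a \<in> K" "A \<in> K" "A \<noteq> - a" and b: "b \<in> K" "B \<in> K" "B \<noteq> - b"
    and "0 \<le> Re (ip (A \<odot> e \<ominus> x) (x \<ominus> a \<odot> e))"
    and "0 \<le> Re (ip (B \<odot> e \<ominus> y) (y \<ominus> b \<odot> e))"
  shows "cmod (ip x y - ip x e * ip e y)
    \<le> 1 / 4 * (cmod (A - a) * cmod (B - b) / sqrt (cmod (A + a) * cmod (B + b)))
        * sqrt (ip_norm ip x + cmod (ip x e)) * sqrt (ip_norm ip y + cmod (ip y e))"
proof -
  let ?x = "x \<ominus> ip x e \<odot> e" and ?y = "y \<ominus> ip y e \<odot> e"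
  have carr: "?x \<in> carrier H" "?y \<in> carrier H"
    using x y e by (simp_all add: ip_simps)
  \<comment> \<open>All three correction terms on the right are multiples of
    \<open>ip x e * ip e y\<close>, with coefficients -1, -1 and +1.\<close>
  have "ip x y - ip x e * ip e y = ip ?x ?y"
    using x y e ip_commute[of y e] by (simp add: ip_simps ip_self)
  also have "cmod \<dots> \<le> ip_norm ip ?x * ip_norm ip ?y"
    by (intro Cauchy_Schwarz carr)
  also have "\<dots> \<le> (1 / 2 * (cmod (A - a) / sqrt (cmod (A + a))) * sqrt (ip_norm ip x + cmod (ip x e)))
      * (1 / 2 * (cmod (B - b) / sqrt (cmod (B + b))) * sqrt (ip_norm ip y + cmod (ip y e)))"
    using assms carr by (intro mult_mono' norm_residual_le ip_norm_nonneg)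
  also have "\<dots> = 1 / 4 * (cmod (A - a) * cmod (B - b) / sqrt (cmod (A + a) * cmod (B + b)))
        * sqrt (ip_norm ip x + cmod (ip x e)) * sqrt (ip_norm ip y + cmod (ip y e))"
    by (simp add: real_sqrt_mult)
  finally show ?thesis .
qed

text \<open>By \<open>cmod_ip_le_of_unit\<close> each sum under a root is at most twice the norm;
  the two roots together contribute the factor 2 that turns 1/4 into 1/2.\<close>

lemma Gruess_bound_le:
  assumes x: "x \<in> carrier H" and y: "y \<in> carrier H" and e: "e \<in> carrier H" "ip_norm ip e = 1"
    and "0 \<le> C"
  shows "1 / 4 * C * sqrt (ip_norm ip x + cmod (ip x e)) * sqrt (ip_norm ip y + cmod (ip y e))
    \<le> 1 / 2 * C * sqrt (ip_norm ip x * ip_norm ip y)"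
proof -
  have "sqrt (ip_norm ip x + cmod (ip x e)) * sqrt (ip_norm ip y + cmod (ip y e))
      = sqrt ((ip_norm ip x + cmod (ip x e)) * (ip_norm ip y + cmod (ip y e)))"
    by (simp add: real_sqrt_mult)
  also have "\<dots> \<le> sqrt ((2 * ip_norm ip x) * (2 * ip_norm ip y))"
    using cmod_ip_le_of_unit[OF x e] cmod_ip_le_of_unit[OF y e]
    by (intro real_sqrt_le_mono mult_mono) (auto simp: ip_norm_nonneg x y)
  also have "\<dots> = 2 * sqrt (ip_norm ip x * ip_norm ip y)"
    by (simp add: real_sqrt_mult)
  finally have "1 / 4 * C * (sqrt (ip_norm ip x + cmod (ip x e)) * sqrt (ip_norm ip y + cmod (ip y e)))
      \<le> 1 / 4 * C * (2 * sqrt (ip_norm ip x * ip_norm ip y))"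
    using \<open>0 \<le> C\<close> by (intro mult_left_mono) auto
  then show ?thesis
    by (simp add: mult.assoc)
qed

end

(* K^2, realised as the sequences supported on the indices 0 and 1. *)
definition plane :: "complex set \<Rightarrow> (complex, nat \<Rightarrow> complex) module" where
  "plane K = \<lparr>carrier = {f. f 0 \<in> K \<and> f 1 \<in> K \<and> (\<forall>n\<ge>2. f n = 0)},
     monoid.mult = (\<lambda>f g n. 0), one = (\<lambda>n. 0), ring.zero = (\<lambda>n. 0), add = (\<lambda>f g n. f n + g n),
     module.smult = (\<lambda>c f n. c * f n)\<rparr>"

definition plane_ip :: "(nat \<Rightarrow> complex) \<Rightarrow> (nat \<Rightarrow> complex) \<Rightarrow> complex" where
  "plane_ip f g = f 0 * cnj (g 0) + f 1 * cnj (g 1)"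

section \<open>The plane as a test space over both fields\<close>

lemma plane_simps [simp]:
  "f \<in> carrier (plane K) \<longleftrightarrow> f 0 \<in> K \<and> f 1 \<in> K \<and> (\<forall>n\<ge>2. f n = 0)"
  "\<zero>\<^bsub>plane K\<^esub> = (\<lambda>n. 0)" "f \<oplus>\<^bsub>plane K\<^esub> g = (\<lambda>n. f n + g n)"
  "c \<odot>\<^bsub>plane K\<^esub> f = (\<lambda>n. c * f n)"
  by (simp_all add: plane_def)

lemma abelian_group_plane:
  assumes "K = \<real> \<or> K = UNIV"
  shows "abelian_group (plane K)"
proof (rule abelian_groupI)
  fix f assume "f \<in> carrier (plane K)"
  then show "\<exists>g\<in>carrier (plane K). g \<oplus>\<^bsub>plane K\<^esub> f = \<zero>\<^bsub>plane K\<^esub>"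
    using assms by (intro bexI[of _ "\<lambda>n. - f n"]) auto
qed (use assms in \<open>auto simp: algebra_simps\<close>)

text \<open>Makes the plane an admissible instance in the proof that 1/4 is optimal, for real and
  complex scalars at once.\<close>

lemma inner_product_space_plane:
  assumes "K = \<real> \<or> K = UNIV"
  shows "inner_product_space K (plane K) plane_ip"
proof -
  have "module (scalar_ring K) (plane K)"
    using assms by (intro moduleI cring_scalar_ring abelian_group_plane) (auto simp: algebra_simps)
  moreover have "f = (\<lambda>n. 0)" if "f \<in> carrier (plane K)" "plane_ip f f = 0" for f
  proof -
    have "(cmod (f 0))\<^sup>2 + (cmod (f 1))\<^sup>2 = 0"
      using arg_cong[OF that(2), of Re] by (simp add: plane_ip_def cmod_power2 flip: power2_eq_square)
    then have f01: "f 0 = 0" "f 1 = 0"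
      by (simp_all add: sum_power2_eq_zero_iff del: One_nat_def)
    show ?thesis
    proof
      fix n :: nat
      consider "n = 0" | "n = 1" | "n \<ge> 2"
        by linarith
      then show "f n = 0"
        using f01 that(1) by cases simp_all
    qed
  qed
  moreover have "cnj z \<in> K" if "z \<in> K" for z
    using assms that by (auto simp: Reals_cnj_iff)
  ultimately show ?thesis
    using assms unfolding inner_product_space_def inner_product_space_axioms_def
    by (auto simp: plane_ip_def algebra_simps)
qed

text \<open>Subtraction is defined through the abstract additive inverse; uniqueness of inverses
  identifies that with pointwise negation.\<close>

lemma plane_minus:
  assumes "K = \<real> \<or> K = UNIV" "f \<in> carrier (plane K)" "g \<in> carrier (plane K)"
  shows "f \<ominus>\<^bsub>plane K\<^esub> g = (\<lambda>n. f n - g n)"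
proof -
  interpret abelian_group "plane K"
    by (rule abelian_group_plane) fact
  have "\<ominus>\<^bsub>plane K\<^esub> g = (\<lambda>n. - g n)"
    using assms by (intro minus_equality) auto
  then show ?thesis
    by (simp add: a_minus_def)
qed

theorem theorem5:
  fixes K :: "complex set"
  assumes "K = \<real> \<or> K = UNIV"
  shows
    "(\<forall>(H :: (complex, 'v) module) ip x y e a A b B.
        inner_product_space K H ip \<and>
        x \<in> carrier H \<and> y \<in> carrier H \<and> e \<in> carrier H \<and> ip_norm ip e = 1 \<and>
        a \<in> K \<and> A \<in> K \<and> b \<in> K \<and> B \<in> K \<and>
        A \<noteq> a \<and> A \<noteq> - a \<and> B \<noteq> b \<and> B \<noteq> - b \<longrightarrow>
        ((Re (ip (A \<odot>\<^bsub>H\<^esub> e \<ominus>\<^bsub>H\<^esub> x) (x \<ominus>\<^bsub>H\<^esub> a \<odot>\<^bsub>H\<^esub> e)) \<ge> 0 \<and>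
          Re (ip (B \<odot>\<^bsub>H\<^esub> e \<ominus>\<^bsub>H\<^esub> y) (y \<ominus>\<^bsub>H\<^esub> b \<odot>\<^bsub>H\<^esub> e)) \<ge> 0)
         \<longleftrightarrow>
         (ip_norm ip (x \<ominus>\<^bsub>H\<^esub> ((a + A) / 2) \<odot>\<^bsub>H\<^esub> e) \<le> 1 / 2 * cmod (A - a) \<and>
          ip_norm ip (y \<ominus>\<^bsub>H\<^esub> ((b + B) / 2) \<odot>\<^bsub>H\<^esub> e) \<le> 1 / 2 * cmod (B - b)))
        \<and>
        ((Re (ip (A \<odot>\<^bsub>H\<^esub> e \<ominus>\<^bsub>H\<^esub> x) (x \<ominus>\<^bsub>H\<^esub> a \<odot>\<^bsub>H\<^esub> e)) \<ge> 0 \<and>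
          Re (ip (B \<odot>\<^bsub>H\<^esub> e \<ominus>\<^bsub>H\<^esub> y) (y \<ominus>\<^bsub>H\<^esub> b \<odot>\<^bsub>H\<^esub> e)) \<ge> 0)
         \<or>
         (ip_norm ip (x \<ominus>\<^bsub>H\<^esub> ((a + A) / 2) \<odot>\<^bsub>H\<^esub> e) \<le> 1 / 2 * cmod (A - a) \<and>
          ip_norm ip (y \<ominus>\<^bsub>H\<^esub> ((b + B) / 2) \<odot>\<^bsub>H\<^esub> e) \<le> 1 / 2 * cmod (B - b))
         \<longrightarrow>
         cmod (ip x y - ip x e * ip e y)
           \<le> 1 / 4 * (cmod (A - a) * cmod (B - b) / sqrt (cmod (A + a) * cmod (B + b)))
              * sqrt (ip_norm ip x + cmod (ip x e)) * sqrt (ip_norm ip y + cmod (ip y e))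
         \<and>
         1 / 4 * (cmod (A - a) * cmod (B - b) / sqrt (cmod (A + a) * cmod (B + b)))
              * sqrt (ip_norm ip x + cmod (ip x e)) * sqrt (ip_norm ip y + cmod (ip y e))
           \<le> 1 / 2 * (cmod (A - a) * cmod (B - b) / sqrt (cmod (A + a) * cmod (B + b)))
              * sqrt (ip_norm ip x * ip_norm ip y)))
     \<and>
     \<not> (\<exists>c :: real. c < 1 / 4 \<and>
       (\<forall>(H :: (complex, nat \<Rightarrow> complex) module) ip x y e a A b B.
          inner_product_space K H ip \<and>
          x \<in> carrier H \<and> y \<in> carrier H \<and> e \<in> carrier H \<and> ip_norm ip e = 1 \<and>
          a \<in> K \<and> A \<in> K \<and> b \<in> K \<and> B \<in> K \<and>
          A \<noteq> a \<and> A \<noteq> - a \<and> B \<noteq> b \<and> B \<noteq> - b \<and>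
          Re (ip (A \<odot>\<^bsub>H\<^esub> e \<ominus>\<^bsub>H\<^esub> x) (x \<ominus>\<^bsub>H\<^esub> a \<odot>\<^bsub>H\<^esub> e)) \<ge> 0 \<and>
          Re (ip (B \<odot>\<^bsub>H\<^esub> e \<ominus>\<^bsub>H\<^esub> y) (y \<ominus>\<^bsub>H\<^esub> b \<odot>\<^bsub>H\<^esub> e)) \<ge> 0 \<longrightarrow>
          cmod (ip x y - ip x e * ip e y)
            \<le> c * (cmod (A - a) * cmod (B - b) / sqrt (cmod (A + a) * cmod (B + b)))
               * sqrt (ip_norm ip x + cmod (ip x e)) * sqrt (ip_norm ip y + cmod (ip y e))))"
\<comment> \<open>Four goals arise: the equivalence, the first inequality, the second inequality,
  and the optimality of 1/4.\<close>
proof (intro conjI allI impI notI, goal_cases)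
  case (1 H ip x y e a A b B)
  then interpret inner_product_space K H ip by blast
  from 1 show ?case by (simp only: Re_ip_nonneg_iff)
next
  case (2 H ip x y e a A b B)
  then interpret inner_product_space K H ip by blast
  from 2 have "0 \<le> Re (ip (A \<odot>\<^bsub>H\<^esub> e \<ominus>\<^bsub>H\<^esub> x) (x \<ominus>\<^bsub>H\<^esub> a \<odot>\<^bsub>H\<^esub> e))"
      "0 \<le> Re (ip (B \<odot>\<^bsub>H\<^esub> e \<ominus>\<^bsub>H\<^esub> y) (y \<ominus>\<^bsub>H\<^esub> b \<odot>\<^bsub>H\<^esub> e))"
    \<comment> \<open>Both alternatives of the hypothesis are rewritten to the ball condition, so
      the disjunction collapses.\<close>
    by (simp_all only: Re_ip_nonneg_iff disj_absorb)
  then show ?case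
    using 2 by (intro Gruess_inequality) auto
next
  case (3 H ip x y e a A b B)
  then interpret inner_product_space K H ip by blast
  from 3 show ?case by (intro Gruess_bound_le) auto
next
  case 4
  then obtain c :: real where c: "c < 1 / 4" and
    bound: "inner_product_space K H ip \<and>
          x \<in> carrier H \<and> y \<in> carrier H \<and> e \<in> carrier H \<and> ip_norm ip e = 1 \<and>
          a \<in> K \<and> A \<in> K \<and> b \<in> K \<and> B \<in> K \<and>
          A \<noteq> a \<and> A \<noteq> - a \<and> B \<noteq> b \<and> B \<noteq> - b \<and>
          Re (ip (A \<odot>\<^bsub>H\<^esub> e \<ominus>\<^bsub>H\<^esub> x) (x \<ominus>\<^bsub>H\<^esub> a \<odot>\<^bsub>H\<^esub> e)) \<ge> 0 \<and>
          Re (ip (B \<odot>\<^bsub>H\<^esub> e \<ominus>\<^bsub>H\<^esub> y) (y \<ominus>\<^bsub>H\<^esub> b \<odot>\<^bsub>H\<^esub> e)) \<ge> 0 \<longrightarrow>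
          cmod (ip x y - ip x e * ip e y)
            \<le> c * (cmod (A - a) * cmod (B - b) / sqrt (cmod (A + a) * cmod (B + b)))
               * sqrt (ip_norm ip x + cmod (ip x e)) * sqrt (ip_norm ip y + cmod (ip y e))"
    for H :: "(complex, nat \<Rightarrow> complex) module" and ip x y e a A b B
    by blast
  \<comment> \<open>The triple 7, 24, 25 keeps all norms rational. With \<open>a = -5\<close> and
    \<open>A = 55\<close> the ball has centre \<open>25 e\<close> and radius 30, and
    \<open>x\<close> lies on its boundary. AM-GM is tight since 25 is half of \<open>A + a\<close>,
    the real-part estimate since \<open>ip x e = 7\<close> is positive, and Cauchy-Schwarz since
    \<open>y = x\<close>.\<close>
  define x e :: "nat \<Rightarrow> complex"
    where "x = (\<lambda>n. if n = 0 then 7 else if n = 1 then 24 else 0)"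
      and "e = (\<lambda>n. if n = 0 then 1 else 0)"
  have K: "numeral n \<in> K" "- numeral n \<in> K" "0 \<in> K" "1 \<in> K" for n
    using assms by auto
  have "sqrt 625 = 25"
    by (rule real_sqrt_unique) auto
  then have norms: "ip_norm plane_ip x = 25" "ip_norm plane_ip e = 1"
    by (simp_all add: ip_norm_def plane_ip_def x_def e_def)
  have xe: "x \<in> carrier (plane K)" "e \<in> carrier (plane K)"
      "55 \<odot>\<^bsub>plane K\<^esub> e \<in> carrier (plane K)" "(- 5) \<odot>\<^bsub>plane K\<^esub> e \<in> carrier (plane K)"
    using K by (simp_all add: x_def e_def)
  \<comment> \<open>The two vectors are (48, -24) and (12, 24), which are orthogonal.\<close>
  have "Re (plane_ip (55 \<odot>\<^bsub>plane K\<^esub> e \<ominus>\<^bsub>plane K\<^esub> x) (x \<ominus>\<^bsub>plane K\<^esub> (- 5) \<odot>\<^bsub>plane K\<^esub> e)) = 0"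
    \<comment> \<open>\<open>plane_simps\<close> is held back so that the membership facts
      \<open>xe\<close> still match the side conditions of \<open>plane_minus\<close>.\<close>
    by (simp add: plane_minus[OF assms] xe del: plane_simps)
       (simp add: plane_ip_def x_def e_def)
  then have "cmod (plane_ip x x - plane_ip x e * plane_ip e x)
      \<le> c * (cmod (55 - (- 5)) * cmod (55 - (- 5)) / sqrt (cmod (55 + (- 5)) * cmod (55 + (- 5))))
        * sqrt (ip_norm plane_ip x + cmod (plane_ip x e))
        * sqrt (ip_norm plane_ip x + cmod (plane_ip x e))"
    using K xe norms inner_product_space_plane[OF assms]
    by (intro bound[rule_format, where H = "plane K"]) (simp del: plane_simps)
  \<comment> \<open>The inequality now reads 576 \<le> 2304 c, that is c \<ge> 1/4.\<close>
  then show False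
    using c norms by (simp add: plane_ip_def x_def e_def)
qed

end
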